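(* Let an $\mathrm{AVI}(C,q,M)$ be given, with $C\subset\mathbb{R}^n$ a nonempty polyhedral convex set, $q\in\mathbb{R}^n$, and $M\in\mathbb{R}^{n\times n}$ invertible on the lineality space of $C$. Let $r\in N_C(\pi_C(x^0))$ for some $x^0\in\mathbb{R}^n$, and let $G_C(x,t)=M\pi_C(x)+q+x-\pi_C(x)-tr$ for $(x,t)\in\mathbb{R}^n\times\mathbb{R}_+$. Define $$\tilde M=M_{\bar Q\bar Q}-M_{\bar QQ}M_{QQ}^{-1}M_{Q\bar Q},\quad \tilde C=\bar Q^TC,\quad \tilde q=(\bar Q^T-M_{\bar QQ}M_{QQ}^{-1}Q^T)q,\quad \tilde x^0=\bar Q^Tx^0,\quad \tilde r=\bar Q^Tr,$$ and $\tilde G_{\tilde C}(\tilde x,t)=\tilde M\pi_{\tilde C}(\tilde x)+\tilde q+\tilde x-\pi_{\tilde C}(\tilde x)-t\tilde r$. Then $\tilde r\in N_{\tilde C}(\pi_{\tilde C}(\tilde x^0))$, and: (1) if $G_C(x^*,t^* )=0$, then $\tilde G_{\tilde C}(\tilde x^*,t^* )=0$ with $\tilde x^*=\bar Q^Tx^*$; (2) conversely, if $\tilde G_{\tilde C}(\tilde x^*,t^* )=0$, then $G_C(x^*,t^* )=0$ with $x^*=\bar Q\tilde x^*+Qy^*$ and $$y^*=-M_{QQ}^{-1}\left(M_{Q\bar Q}\,\pi_{\tilde C}(\tilde x^* )+Q^Tq\right).$$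
   Context: $\mathrm{AVI}(C,q,M)$: find $z\in C$ with $\langle Mz+q,y-z\rangle\ge0$ for all $y\in C$. $Q$ and $\bar Q$ are matrices whose columns are orthonormal bases of the lineality space $\operatorname{lin}C$ and of its orthogonal complement, respectively. For matrices $P,R$ of suitable sizes, $M_{PR}:=P^TMR$ (so $M_{Q\bar Q}=Q^TM\bar Q$, etc.). "$M$ is invertible on the lineality space of $C$" means $M_{QQ}=Q^TMQ$ is invertible. $\pi_S$ is the Euclidean projection onto $S$ and $N_S(z)=\{y:\langle y,z'-z\rangle\le0\ \forall z'\in S\}$. *)

theory Defs
  imports
    Complex_Main
    "Jordan_Normal_Form.VS_Connect"
    "Jordan_Normal_Form.Gauss_Jordan_Elimination"
begin

text \<open>
  Euclidean space of dimension \<open>n\<close> is \<open>carrier_vec n\<close>, and a set in it is a subset of that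
  carrier.  Dimensions are natural numbers rather than types because the lineality space and its
  orthogonal complement have dimensions that depend on the set, and either may be 0.
\<close>

definition polyhedral_convex :: "nat \<Rightarrow> real vec set \<Rightarrow> bool" where
  "polyhedral_convex n C \<longleftrightarrow>
     (\<exists>m A b. A \<in> carrier_mat m n \<and> b \<in> carrier_vec m \<and>
        C = {x \<in> carrier_vec n. A *\<^sub>v x \<le> b})"

definition recession_cone :: "nat \<Rightarrow> real vec set \<Rightarrow> real vec set" where
  "recession_cone n C =
     {d \<in> carrier_vec n. \<forall>x\<in>C. \<forall>s\<ge>0. x + s \<cdot>\<^sub>v d \<in> C}"

definition lineality_space :: "nat \<Rightarrow> real vec set \<Rightarrow> real vec set" where
  "lineality_space n C = {d \<in> recession_cone n C. - d \<in> recession_cone n C}"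

definition vec_length :: "real vec \<Rightarrow> real" where
  "vec_length v = sqrt (v \<bullet> v)"

text \<open>The value is meaningful only when the minimizer exists and is unique, in particular for
  closed convex nonempty \<open>S\<close>.\<close>

definition euclidean_proj :: "real vec set \<Rightarrow> real vec \<Rightarrow> real vec" where
  "euclidean_proj S x =
     (THE p. p \<in> S \<and> (\<forall>y\<in>S. vec_length (x - p) \<le> vec_length (x - y)))"

definition normal_cone :: "nat \<Rightarrow> real vec set \<Rightarrow> real vec \<Rightarrow> real vec set" where
  "normal_cone n S z = {y \<in> carrier_vec n. \<forall>z'\<in>S. y \<bullet> (z' - z) \<le> 0}"

definition orthonormal_basis_cols :: "nat \<Rightarrow> nat \<Rightarrow> real mat \<Rightarrow> real vec set \<Rightarrow> bool" where
  "orthonormal_basis_cols n k Q S \<longleftrightarrow>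
     Q \<in> carrier_mat n k \<and>
     (\<forall>i<k. \<forall>j<k. col Q i \<bullet> col Q j = (if i = j then 1 else 0)) \<and>
     vec_space.col_space n Q = S"

definition sandwich :: "real mat \<Rightarrow> real mat \<Rightarrow> real mat \<Rightarrow> real mat" where
  "sandwich P M R = P\<^sup>T * M * R"

text \<open>\<open>mat_inverse\<close> returns \<open>None\<close> on singular matrices, where the value below is unspecified.\<close>

definition mat_inv :: "real mat \<Rightarrow> real mat" where
  "mat_inv A = the (mat_inverse A)"

definition normal_map_homotopy ::
  "real vec set \<Rightarrow> real vec \<Rightarrow> real mat \<Rightarrow> real vec \<Rightarrow> real vec \<Rightarrow> real \<Rightarrow> real vec" where
  "normal_map_homotopy C q M r x t =
     M *\<^sub>v euclidean_proj C x + q + x - euclidean_proj C x - t \<cdot>\<^sub>v r"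

end

theory Submission
  imports Defs
begin

text \<open>Since \<open>C\<close> is invariant under translation along its lineality space, the variational
  inequality for \<open>p = \<pi>\<^sub>C(x)\<close> forces \<open>x - p\<close>, and likewise \<open>r\<close>, to be orthogonal to that space.
  Hence \<open>Q\<^sup>T p = Q\<^sup>T x\<close>, and the inner products in the variational inequality survive the map
  \<open>Qbar\<^sup>T\<close>, so \<open>Qbar\<^sup>T p\<close> is the projection of \<open>Qbar\<^sup>T x\<close> onto \<open>Qbar\<^sup>T C\<close>. Splitting \<open>G\<^sub>C(x,t) = 0\<close>
  along the two subspaces then gives a block linear system from which \<open>Q\<^sup>T x\<close> is eliminated by a
  Schur complement; both implications are instances of one equivalence. Projections onto \<open>C\<close>
  exist because a minimizing sequence is Cauchy by the parallelogram law.\<close>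

section \<open>Inner-product preliminaries on \<open>carrier_vec n\<close>\<close>

lemma vec_length_le_iff:
  "vec_length u \<le> vec_length v \<longleftrightarrow> u \<bullet> u \<le> v \<bullet> v"
  by (simp add: vec_length_def)

lemma self_scalar_prod_ge_0: "0 \<le> (v :: real vec) \<bullet> v"
  by (simp add: scalar_prod_def sum_nonneg)

lemma self_scalar_prod_le_0:
  fixes v :: "real vec"
  assumes "v \<in> carrier_vec n" "v \<bullet> v \<le> 0"
  shows "v = 0\<^sub>v n"
  using assms conjugate_square_eq_0_vec[of v n] self_scalar_prod_ge_0[of v] by simp

lemma eq_if_diff_eq_zero_vec:
  fixes u v :: "'a :: ab_group_add vec"
  assumes "u \<in> carrier_vec n" "v \<in> carrier_vec n" "u - v = 0\<^sub>v n"
  shows "u = v"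
proof (rule eq_vecI)
  fix i assume "i < dim_vec v"
  then have "i < n" using assms by simp
  moreover have "(u - v) $ i = 0" using \<open>i < n\<close> by (simp add: assms(3))
  ultimately show "u $ i = v $ i" using assms(1,2) by simp
qed (use assms in simp)

lemma add_diff_cancel_left_vec:
  fixes u v :: "'a :: ab_group_add vec"
  assumes "u \<in> carrier_vec n" "v \<in> carrier_vec n"
  shows "u + v - u = v"
  using assms by (intro eq_vecI) auto

lemma add_diff_cancel_right_vec:
  fixes u v :: "'a :: ab_group_add vec"
  assumes "u \<in> carrier_vec n" "v \<in> carrier_vec n"
  shows "u + (v - u) = v"
  using assms by (intro eq_vecI) auto

lemma index_sq_le_self_scalar_prod:
  fixes v :: "real vec"
  assumes "v \<in> carrier_vec n" "i < n"
  shows "(v $ i)\<^sup>2 \<le> v \<bullet> v"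
proof -
  have "(v $ i)\<^sup>2 \<le> (\<Sum>j\<in>{0..<n}. (v $ j)\<^sup>2)"
    using assms by (intro member_le_sum) auto
  then show ?thesis
    using assms by (simp add: scalar_prod_def power2_eq_square)
qed

text \<open>The parallelogram law for \<open>x - y\<close> and \<open>x - z\<close>, whose sum is
  twice \<open>x - m\<close>. The midpoint is spelled with \<open>1 - 1/2\<close> so that it matches
  a convex combination taken at \<open>s = 1/2\<close>.\<close>

lemma parallelogram_midpoint:
  fixes x y z :: "real vec"
  assumes "x \<in> carrier_vec n" "y \<in> carrier_vec n" "z \<in> carrier_vec n"
  defines "m \<equiv> (1 - 1/2) \<cdot>\<^sub>v y + (1/2) \<cdot>\<^sub>v z"
  shows "(y - z) \<bullet> (y - z)
    = 2 * ((x - y) \<bullet> (x - y)) + 2 * ((x - z) \<bullet> (x - z)) - 4 * ((x - m) \<bullet> (x - m))"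
  using assms(1-3) comm_scalar_prod[of x n y] comm_scalar_prod[of x n z] comm_scalar_prod[of y n z]
  by (simp add: m_def scalar_prod_minus_distrib[of _ n] minus_scalar_prod_distrib[of _ n]
      scalar_prod_add_distrib[of _ n] add_scalar_prod_distrib[of _ n] diff_divide_distrib
      add_divide_distrib)

lemma self_scalar_prod_diff_add_smult:
  fixes u v :: "real vec"
  assumes "u \<in> carrier_vec n" "v \<in> carrier_vec n"
  shows "(u - s \<cdot>\<^sub>v v) \<bullet> (u - s \<cdot>\<^sub>v v) = u \<bullet> u - 2 * s * (u \<bullet> v) + s\<^sup>2 * (v \<bullet> v)"
  using assms comm_scalar_prod[of u n v]
  by (simp add: scalar_prod_minus_distrib[of _ n] minus_scalar_prod_distrib[of _ n]
      power2_eq_square algebra_simps)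

section \<open>Euclidean projection: variational characterization and existence\<close>

text \<open>Resolves the \<open>THE\<close> in \<open>euclidean_proj\<close> from the variational
  inequality alone. This is how projections onto the image of \<open>C\<close> are identified later,
  without polyhedrality of that image.\<close>

lemma euclidean_proj_eqI:
  fixes x :: "real vec"
  assumes S: "S \<subseteq> carrier_vec n" and x: "x \<in> carrier_vec n" and p: "p \<in> S"
    and VI: "\<And>y. y \<in> S \<Longrightarrow> (x - p) \<bullet> (y - p) \<le> 0"
  shows "euclidean_proj S x = p"
  unfolding euclidean_proj_def
proof (rule the_equality)
  have carrier: "dim_vec y = n" if "y \<in> S" for y
    using S that by auto
  note carrier [OF p, simp]
  \<comment> \<open>Expanding the squared distance around \<open>p\<close>, the variational
    inequality gives the cross term a favourable sign. The surplus
    \<open>(y - p) \<bullet> (y - p)\<close> then yields uniqueness as well as minimality.\<close>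
  have far: "(x - p) \<bullet> (x - p) + (y - p) \<bullet> (y - p) \<le> (x - y) \<bullet> (x - y)" if "y \<in> S" for y
  proof -
    have "x - y = (x - p) - 1 \<cdot>\<^sub>v (y - p)"
      using carrier x that by (intro eq_vecI) auto
    moreover have "x - p \<in> carrier_vec n" "y - p \<in> carrier_vec n"
      using carrier x p by (auto intro!: carrier_vecI)
    ultimately have "(x - y) \<bullet> (x - y)
        = (x - p) \<bullet> (x - p) - 2 * 1 * ((x - p) \<bullet> (y - p)) + 1\<^sup>2 * ((y - p) \<bullet> (y - p))"
      using self_scalar_prod_diff_add_smult by presburger
    then show ?thesis
      using VI[OF that] by simp
  qed
  have "(x - p) \<bullet> (x - p) \<le> (x - y) \<bullet> (x - y)" if "y \<in> S" for y
    using far[OF that] self_scalar_prod_ge_0[of "y - p"] by linarith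
  then show "p \<in> S \<and> (\<forall>y\<in>S. vec_length (x - p) \<le> vec_length (x - y))"
    using p by (simp add: vec_length_le_iff)
  fix p' assume p': "p' \<in> S \<and> (\<forall>y\<in>S. vec_length (x - p') \<le> vec_length (x - y))"
  then have "(x - p') \<bullet> (x - p') \<le> (x - p) \<bullet> (x - p)"
    using p by (simp add: vec_length_le_iff)
  then have "(p' - p) \<bullet> (p' - p) \<le> 0"
    using far[of p'] p' by linarith
  moreover have "p' - p \<in> carrier_vec n" "p \<in> carrier_vec n" "p' \<in> carrier_vec n"
    using carrier p p' by (auto intro!: carrier_vecI)
  ultimately show "p' = p"
    using self_scalar_prod_le_0[of "p' - p" n] eq_if_diff_eq_zero_vec[of p' n p] by blast
qed

text \<open>Moving from \<open>p\<close> a fraction \<open>s\<close> towards \<open>y\<close>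
  changes the squared distance by \<open>s * (s * ?b - 2 * ?a)\<close>. If \<open>?a\<close> were
  positive, a small step would therefore come strictly closer to \<open>x\<close>.\<close>

lemma convex_nearest_point_VI:
  fixes x :: "real vec"
  assumes S: "S \<subseteq> carrier_vec n" and x: "x \<in> carrier_vec n" and p: "p \<in> S" and y: "y \<in> S"
    and convex: "\<And>s. 0 \<le> s \<Longrightarrow> s \<le> 1 \<Longrightarrow> (1 - s) \<cdot>\<^sub>v p + s \<cdot>\<^sub>v y \<in> S"
    and nearest: "\<And>z. z \<in> S \<Longrightarrow> (x - p) \<bullet> (x - p) \<le> (x - z) \<bullet> (x - z)"
  shows "(x - p) \<bullet> (y - p) \<le> 0"
proof (rule ccontr)
  have py: "p \<in> carrier_vec n" "y \<in> carrier_vec n"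
    using S p y by auto
  let ?a = "(x - p) \<bullet> (y - p)" and ?b = "(y - p) \<bullet> (y - p)"
  assume "\<not> ?a \<le> 0"
  then have a: "0 < ?a" by (simp only: not_le)
  \<comment> \<open>The cap 1 keeps the point on the segment, and the quotient ensures
    \<open>s * ?b \<le> ?a\<close>. The \<open>+ 1\<close> makes the denominator positive even when
    \<open>?b\<close> is 0.\<close>
  define s where "s = min 1 (?a / (?b + 1))"
  have b: "0 \<le> ?b" by (rule self_scalar_prod_ge_0)
  have s: "0 < s" "s \<le> 1" "s \<le> ?a / (?b + 1)"
    using a b by (auto simp: s_def)
  have "s * ?b \<le> s * (?b + 1)" using s by simp
  also have "\<dots> \<le> ?a" using s b by (simp add: pos_le_divide_eq)
  finally have sb: "s * ?b \<le> ?a" .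
  have "x - ((1 - s) \<cdot>\<^sub>v p + s \<cdot>\<^sub>v y) = (x - p) - s \<cdot>\<^sub>v (y - p)"
    using x py by (intro eq_vecI) (auto simp: algebra_simps)
  then have "0 \<le> s * (s * ?b - 2 * ?a)"
    using nearest[OF convex, of s] s self_scalar_prod_diff_add_smult[of "x - p" n "y - p" s] x py p y
    by (auto simp: algebra_simps power2_eq_square)
  then have "2 * ?a \<le> s * ?b"
    using s by (simp add: zero_le_mult_iff)
  with sb a show False by simp
qed

text \<open>Closedness is phrased through coordinatewise limits of sequences, so completeness of the
  reals, applied to one coordinate at a time, supplies the limit of a minimizing sequence.\<close>

lemma closed_convex_nearest_point:
  fixes S :: "real vec set"
  assumes S: "S \<subseteq> carrier_vec n" "S \<noteq> {}" and x: "x \<in> carrier_vec n"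
    and convex: "\<And>y z s. y \<in> S \<Longrightarrow> z \<in> S \<Longrightarrow> 0 \<le> s \<Longrightarrow> s \<le> 1
      \<Longrightarrow> (1 - s) \<cdot>\<^sub>v y + s \<cdot>\<^sub>v z \<in> S"
    and closed: "\<And>f p. \<forall>i :: nat. f i \<in> S \<Longrightarrow> p \<in> carrier_vec n
      \<Longrightarrow> \<forall>j<n. (\<lambda>i. f i $ j) \<longlonglongrightarrow> p $ j \<Longrightarrow> p \<in> S"
  obtains p where "p \<in> S" "\<And>z. z \<in> S \<Longrightarrow> (x - p) \<bullet> (x - p) \<le> (x - z) \<bullet> (x - z)"
proof -
  define D where "D = (\<lambda>y. (x - y) \<bullet> (x - y)) ` S"
  have D: "D \<noteq> {}" "bdd_below D"
    using S self_scalar_prod_ge_0 by (auto simp: D_def intro!: bdd_belowI)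
  have lower: "Inf D \<le> (x - y) \<bullet> (x - y)" if "y \<in> S" for y
    using D that by (intro cInf_lower) (auto simp: D_def)
  have "\<exists>y\<in>S. (x - y) \<bullet> (x - y) < Inf D + 1 / Suc i" for i
    using cInf_lessD[of D "Inf D + 1 / Suc i"] D by (auto simp: D_def)
  then obtain f where f: "\<And>i. f i \<in> S"
    and f_lt: "\<And>i. (x - f i) \<bullet> (x - f i) < Inf D + 1 / Suc i"
    by metis
  have f_carrier: "f i \<in> carrier_vec n" for i
    using f S by auto
  \<comment> \<open>The midpoint of \<open>f i\<close> and \<open>f i'\<close> lies in
    \<open>S\<close>, so its squared distance is at least \<open>Inf D\<close>. In the parallelogram
    law the multiples of \<open>Inf D\<close> then cancel and only the two errors remain.\<close>
  have gap: "(f i $ j - f i' $ j)\<^sup>2 \<le> 2 / Suc i + 2 / Suc i'" if "j < n" for i i' j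
  proof -
    have "(f i $ j - f i' $ j)\<^sup>2 \<le> (f i - f i') \<bullet> (f i - f i')"
      using index_sq_le_self_scalar_prod[of "f i - f i'" n j] that f_carrier[of i] f_carrier[of i']
      by simp
    also have "\<dots> \<le> 2 / Suc i + 2 / Suc i'"
      using parallelogram_midpoint[OF x f_carrier[of i] f_carrier[of i']]
        lower[OF convex[OF f[of i] f[of i'], of "1/2"]] f_lt[of i] f_lt[of i']
      by simp
    finally show ?thesis .
  qed
  have "Cauchy (\<lambda>i. f i $ j)" if j: "j < n" for j
  proof (rule metric_CauchyI)
    fix e :: real assume e: "0 < e"
    \<comment> \<open>Beyond \<open>N\<close> the bound in \<open>gap\<close> is at most
      \<open>4 / Suc N\<close>, hence the choice of a quarter of the square of
      \<open>e\<close>.\<close>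
    then obtain N where N: "inverse (real (Suc N)) < e\<^sup>2 / 4"
      using reals_Archimedean[of "e\<^sup>2 / 4"] by auto
    have "dist (f i $ j) (f i' $ j) < e" if "N \<le> i" "N \<le> i'" for i i'
    proof -
      have "2 / Suc i + 2 / Suc i' \<le> 2 / Suc N + 2 / Suc N"
        using that by (intro add_mono divide_left_mono) auto
      then have "(f i $ j - f i' $ j)\<^sup>2 < e\<^sup>2"
        using gap[OF j, of i i'] N by (simp add: inverse_eq_divide)
      then show ?thesis
        using e by (simp add: dist_real_def abs_le_square_iff[of e, symmetric] flip: not_le)
    qed
    then show "\<exists>N. \<forall>i\<ge>N. \<forall>i'\<ge>N. dist (f i $ j) (f i' $ j) < e" by blast
  qed
  then have conv: "(\<lambda>i. f i $ j) \<longlonglongrightarrow> lim (\<lambda>i. f i $ j)" if "j < n" for j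
    using that real_Cauchy_convergent convergent_LIMSEQ_iff by blast
  define p where "p = vec n (\<lambda>j. lim (\<lambda>i. f i $ j))"
  have p: "p \<in> carrier_vec n" and conv_p: "\<And>j. j < n \<Longrightarrow> (\<lambda>i. f i $ j) \<longlonglongrightarrow> p $ j"
    using conv by (auto simp: p_def)
  have "(\<lambda>i. \<Sum>j\<in>{0..<n}. (x $ j - f i $ j) * (x $ j - f i $ j))
      \<longlonglongrightarrow> (\<Sum>j\<in>{0..<n}. (x $ j - p $ j) * (x $ j - p $ j))"
    using conv_p by (intro tendsto_intros) auto
  then have "(\<lambda>i. (x - f i) \<bullet> (x - f i)) \<longlonglongrightarrow> (x - p) \<bullet> (x - p)"
    using p x f_carrier[THEN carrier_vecD] by (simp add: scalar_prod_def)
  moreover have "(\<lambda>i. Inf D + 1 / Suc i) \<longlonglongrightarrow> Inf D + 0"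
    using LIMSEQ_inverse_real_of_nat by (intro tendsto_intros) (simp add: inverse_eq_divide)
  ultimately have "(x - p) \<bullet> (x - p) \<le> Inf D + 0"
    using f_lt by (intro LIMSEQ_le) (auto intro: less_imp_le)
  moreover have "p \<in> S"
    using closed[of f p] f p conv_p by blast
  ultimately show ?thesis
    using that[of p] lower by force
qed

text \<open>Each row of the system is a half-space condition, preserved by convex combinations and
  by coordinatewise limits. The three conclusions are the properties of the set that
  \<open>closed_convex_nearest_point\<close> asks for.\<close>

lemma polyhedral_convexD:
  assumes "polyhedral_convex n C"
  shows "C \<subseteq> carrier_vec n"
    and "y \<in> C \<Longrightarrow> z \<in> C \<Longrightarrow> 0 \<le> s \<Longrightarrow> s \<le> 1 \<Longrightarrow> (1 - s) \<cdot>\<^sub>v y + s \<cdot>\<^sub>v z \<in> C"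
    and "\<forall>i :: nat. f i \<in> C \<Longrightarrow> p \<in> carrier_vec n
      \<Longrightarrow> \<forall>j<n. (\<lambda>i. f i $ j) \<longlonglongrightarrow> p $ j \<Longrightarrow> p \<in> C"
proof -
  obtain m A b where A: "A \<in> carrier_mat m n" and b: "b \<in> carrier_vec m"
    and C: "C = {x \<in> carrier_vec n. A *\<^sub>v x \<le> b}"
    using assms unfolding polyhedral_convex_def by auto
  have C: "x \<in> C \<longleftrightarrow> x \<in> carrier_vec n \<and> (\<forall>i<m. row A i \<bullet> x \<le> b $ i)" for x
    using A b by (auto simp: C less_eq_vec_def)
  have row: "row A i \<in> carrier_vec n" if "i < m" for i
    using A that by auto
  show "C \<subseteq> carrier_vec n"
    using C by auto
  show "(1 - s) \<cdot>\<^sub>v y + s \<cdot>\<^sub>v z \<in> C" if "y \<in> C" "z \<in> C" "0 \<le> s" "s \<le> 1"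
  proof -
    have "row A i \<bullet> ((1 - s) \<cdot>\<^sub>v y + s \<cdot>\<^sub>v z) \<le> b $ i" if i: "i < m" for i
    proof -
      have "row A i \<bullet> ((1 - s) \<cdot>\<^sub>v y + s \<cdot>\<^sub>v z) = (1 - s) * (row A i \<bullet> y) + s * (row A i \<bullet> z)"
        using \<open>y \<in> C\<close> \<open>z \<in> C\<close> row[OF i] C by (simp add: scalar_prod_add_distrib[of _ n])
      also have "\<dots> \<le> (1 - s) * b $ i + s * b $ i"
        using \<open>y \<in> C\<close> \<open>z \<in> C\<close> \<open>0 \<le> s\<close> \<open>s \<le> 1\<close> i C by (intro add_mono mult_left_mono) auto
      finally show ?thesis by (simp add: algebra_simps)
    qed
    then show ?thesis using that C by auto
  qed
  show "p \<in> C" if f: "\<forall>i. f i \<in> C" and p: "p \<in> carrier_vec n"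
    and lim: "\<forall>j<n. (\<lambda>i. f i $ j) \<longlonglongrightarrow> p $ j" for f :: "nat \<Rightarrow> real vec"
  proof -
    have "row A i \<bullet> p \<le> b $ i" if i: "i < m" for i
    proof (rule LIMSEQ_le_const2)
      have "(\<lambda>k. \<Sum>j\<in>{0..<n}. row A i $ j * f k $ j) \<longlonglongrightarrow> (\<Sum>j\<in>{0..<n}. row A i $ j * p $ j)"
        using lim by (intro tendsto_intros) auto
      moreover have "dim_vec (f k) = n" for k
        using f C by auto
      ultimately show "(\<lambda>k. row A i \<bullet> f k) \<longlonglongrightarrow> row A i \<bullet> p"
        using p by (simp add: scalar_prod_def)
      show "\<exists>N. \<forall>k\<ge>N. row A i \<bullet> f k \<le> b $ i"
        using f C i by auto
    qed
    with p C show ?thesis by auto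
  qed
qed

lemma polyhedral_convex_proj:
  assumes C: "polyhedral_convex n C" "C \<noteq> {}" and x: "x \<in> carrier_vec n"
  shows "euclidean_proj C x \<in> C"
    and "y \<in> C \<Longrightarrow> (x - euclidean_proj C x) \<bullet> (y - euclidean_proj C x) \<le> 0"
proof -
  note poly = polyhedral_convexD[OF C(1)]
  obtain p where p: "p \<in> C" and nearest: "\<And>z. z \<in> C \<Longrightarrow> (x - p) \<bullet> (x - p) \<le> (x - z) \<bullet> (x - z)"
    by (rule closed_convex_nearest_point[OF poly(1) C(2) x]) (rule poly(2,3); assumption | blast)+
  have VI: "(x - p) \<bullet> (y - p) \<le> 0" if "y \<in> C" for y
    using convex_nearest_point_VI[OF poly(1) x p that poly(2)[OF p that] nearest] .
  have "euclidean_proj C x = p"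
    by (rule euclidean_proj_eqI[OF poly(1) x p VI])
  then show "euclidean_proj C x \<in> C"
    and "y \<in> C \<Longrightarrow> (x - euclidean_proj C x) \<bullet> (y - euclidean_proj C x) \<le> 0"
    using p VI by auto
qed

section \<open>Lineality space, orthonormal bases and matrix inverses\<close>

lemma lineality_space_add:
  assumes "y \<in> C" "d \<in> lineality_space n C"
  shows "y + d \<in> C"
proof -
  have "y + 1 \<cdot>\<^sub>v d \<in> C"
    using assms unfolding lineality_space_def recession_cone_def
    by (metis (no_types, lifting) mem_Collect_eq zero_le_one)
  then show ?thesis by simp
qed

lemma orthonormal_basis_colsD:
  assumes "orthonormal_basis_cols n k Q S"
  shows "Q \<in> carrier_mat n k" and "Q\<^sup>T * Q = 1\<^sub>m k"
    and "S = {Q *\<^sub>v w |w. w \<in> carrier_vec k}"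
proof -
  show Q: "Q \<in> carrier_mat n k"
    using assms by (simp add: orthonormal_basis_cols_def)
  show "Q\<^sup>T * Q = 1\<^sub>m k"
    using assms Q by (intro eq_matI) (auto simp: orthonormal_basis_cols_def)
  show "S = {Q *\<^sub>v w |w. w \<in> carrier_vec k}"
    using assms Q unfolding orthonormal_basis_cols_def vec_space.col_space_eq[OF Q] by auto
qed

lemma mult_mat_zero_vec:
  fixes A :: "'a :: semiring_0 mat"
  assumes "A \<in> carrier_mat m n"
  shows "A *\<^sub>v 0\<^sub>v n = 0\<^sub>v m"
  using assms by (intro eq_vecI) auto

lemma zero_mat_mult_vec:
  "v \<in> carrier_vec n \<Longrightarrow> 0\<^sub>m m n *\<^sub>v v = (0\<^sub>v m :: 'a :: semiring_0 vec)"
  by (intro eq_vecI) auto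

text \<open>\<open>mat_inverse\<close> can return \<open>None\<close> only for a matrix that is not
  a unit of the matrix ring. Invertibility is therefore recast as membership in
  \<open>Units\<close>, which gives the \<open>the\<close> in \<open>mat_inv\<close> a definite
  value.\<close>

lemma mat_inv_inverse:
  assumes A: "A \<in> carrier_mat n n" and inv: "invertible_mat A"
  shows "mat_inv A \<in> carrier_mat n n" "A * mat_inv A = 1\<^sub>m n" "mat_inv A * A = 1\<^sub>m n"
proof -
  obtain B where B: "A * B = 1\<^sub>m n" "B * A = 1\<^sub>m (dim_row B)"
    using inv A by (auto simp: invertible_mat_def inverts_mat_def)
  \<comment> \<open>Comparing dimensions in the two products with the identity matrices shows that
    the inverse is square of size \<open>n\<close>.\<close>
  have "B \<in> carrier_mat n n"
    using A B by (metis carrier_matD carrier_matI index_mult_mat(2,3) index_one_mat(2,3))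
  with A B have "A \<in> Units (ring_mat TYPE(real) n ())"
    by (auto simp: Units_def ring_mat_def)
  then obtain B' where "mat_inverse A = Some B'"
    using mat_inverse(1)[OF A] by fastforce
  then show "mat_inv A \<in> carrier_mat n n" "A * mat_inv A = 1\<^sub>m n" "mat_inv A * A = 1\<^sub>m n"
    using mat_inverse(2)[OF A] by (auto simp: mat_inv_def)
qed

section \<open>Coordinates along two complementary orthonormal bases\<close>

text \<open>The assumptions say that the block matrix formed by \<open>Q\<close> and
  \<open>Qbar\<close> is orthogonal. The last one is the resolution of the identity, stated on
  vectors.\<close>

locale orthogonal_splitting =
  fixes n k l :: nat and Q Qbar :: "real mat"
  assumes Q: "Q \<in> carrier_mat n k" and Qbar: "Qbar \<in> carrier_mat n l"
    and QtQ: "Q\<^sup>T * Q = 1\<^sub>m k" and QbtQb: "Qbar\<^sup>T * Qbar = 1\<^sub>m l"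
    and QtQb: "Q\<^sup>T * Qbar = 0\<^sub>m k l" and QbtQ: "Qbar\<^sup>T * Q = 0\<^sub>m l k"
    and split: "v \<in> carrier_vec n \<Longrightarrow> Q *\<^sub>v (Q\<^sup>T *\<^sub>v v) + Qbar *\<^sub>v (Qbar\<^sup>T *\<^sub>v v) = v"
begin

lemma Q_carrier [simp]: "Q \<in> carrier_mat n k" "Q\<^sup>T \<in> carrier_mat k n"
    "Qbar \<in> carrier_mat n l" "Qbar\<^sup>T \<in> carrier_mat l n"
  using Q Qbar by auto

lemma transpose_mult_vec [simp]:
  "w \<in> carrier_vec k \<Longrightarrow> Q\<^sup>T *\<^sub>v (Q *\<^sub>v w) = w"
  "w \<in> carrier_vec k \<Longrightarrow> Qbar\<^sup>T *\<^sub>v (Q *\<^sub>v w) = 0\<^sub>v l"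
  "z \<in> carrier_vec l \<Longrightarrow> Q\<^sup>T *\<^sub>v (Qbar *\<^sub>v z) = 0\<^sub>v k"
  "z \<in> carrier_vec l \<Longrightarrow> Qbar\<^sup>T *\<^sub>v (Qbar *\<^sub>v z) = z"
  using assoc_mult_mat_vec[OF Q_carrier(2,1), symmetric] assoc_mult_mat_vec[OF Q_carrier(4,1), symmetric]
    assoc_mult_mat_vec[OF Q_carrier(2,3), symmetric] assoc_mult_mat_vec[OF Q_carrier(4,3), symmetric]
  by (simp_all add: QtQ QtQb QbtQ QbtQb zero_mat_mult_vec)

lemma mult_vec_closed [simp]:
  "w \<in> carrier_vec k \<Longrightarrow> Q *\<^sub>v w \<in> carrier_vec n"
  "z \<in> carrier_vec l \<Longrightarrow> Qbar *\<^sub>v z \<in> carrier_vec n"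
  "v \<in> carrier_vec n \<Longrightarrow> Q\<^sup>T *\<^sub>v v \<in> carrier_vec k"
  "v \<in> carrier_vec n \<Longrightarrow> Qbar\<^sup>T *\<^sub>v v \<in> carrier_vec l"
  by (rule mult_mat_vec_carrier; simp)+

text \<open>By the resolution of the identity the two coordinate blocks determine \<open>v\<close>,
  so a vector equation may be checked block by block.\<close>

lemma eq_zero_iff:
  assumes "v \<in> carrier_vec n"
  shows "v = 0\<^sub>v n \<longleftrightarrow> Q\<^sup>T *\<^sub>v v = 0\<^sub>v k \<and> Qbar\<^sup>T *\<^sub>v v = 0\<^sub>v l"
proof
  assume "Q\<^sup>T *\<^sub>v v = 0\<^sub>v k \<and> Qbar\<^sup>T *\<^sub>v v = 0\<^sub>v l"
  then show "v = 0\<^sub>v n"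
    using split[OF assms] by (simp add: mult_mat_zero_vec[OF Q] mult_mat_zero_vec[OF Qbar])
qed (simp add: mult_mat_zero_vec[of _ _ n])

lemma scalar_prod_split:
  assumes u: "u \<in> carrier_vec n" and v: "v \<in> carrier_vec n"
  shows "u \<bullet> v = (Q\<^sup>T *\<^sub>v u) \<bullet> (Q\<^sup>T *\<^sub>v v) + (Qbar\<^sup>T *\<^sub>v u) \<bullet> (Qbar\<^sup>T *\<^sub>v v)"
proof -
  have "u \<bullet> v = u \<bullet> (Q *\<^sub>v (Q\<^sup>T *\<^sub>v v) + Qbar *\<^sub>v (Qbar\<^sup>T *\<^sub>v v))"
    using split[OF v] by simp
  also have "\<dots> = u \<bullet> (Q *\<^sub>v (Q\<^sup>T *\<^sub>v v)) + u \<bullet> (Qbar *\<^sub>v (Qbar\<^sup>T *\<^sub>v v))"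
    using u v by (intro scalar_prod_add_distrib[of _ n]) auto
  also have "\<dots> = (Q\<^sup>T *\<^sub>v u) \<bullet> (Q\<^sup>T *\<^sub>v v) + (Qbar\<^sup>T *\<^sub>v u) \<bullet> (Qbar\<^sup>T *\<^sub>v v)"
    using transpose_vec_mult_scalar[OF Q _ u, of "Q\<^sup>T *\<^sub>v v"]
      transpose_vec_mult_scalar[OF Qbar _ u, of "Qbar\<^sup>T *\<^sub>v v"] v
    by simp
  finally show ?thesis .
qed

text \<open>The number of rows of \<open>N\<close> is left free so that \<open>N\<close> can be
  either \<open>Q\<^sup>T * M\<close> or \<open>Qbar\<^sup>T * M\<close>, which produces the block
  rows of \<open>M\<close>.\<close>

lemma mult_vec_split:
  assumes N: "N \<in> carrier_mat m n" and v: "v \<in> carrier_vec n"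
  shows "N *\<^sub>v v = (N * Q) *\<^sub>v (Q\<^sup>T *\<^sub>v v) + (N * Qbar) *\<^sub>v (Qbar\<^sup>T *\<^sub>v v)"
proof -
  have "N *\<^sub>v v = N *\<^sub>v (Q *\<^sub>v (Q\<^sup>T *\<^sub>v v) + Qbar *\<^sub>v (Qbar\<^sup>T *\<^sub>v v))"
    using split[OF v] by simp
  also have "\<dots> = N *\<^sub>v (Q *\<^sub>v (Q\<^sup>T *\<^sub>v v)) + N *\<^sub>v (Qbar *\<^sub>v (Qbar\<^sup>T *\<^sub>v v))"
    using N v by (intro mult_add_distrib_mat_vec) auto
  also have "\<dots> = (N * Q) *\<^sub>v (Q\<^sup>T *\<^sub>v v) + (N * Qbar) *\<^sub>v (Qbar\<^sup>T *\<^sub>v v)"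
    using assoc_mult_mat_vec[OF N Q, of "Q\<^sup>T *\<^sub>v v"]
      assoc_mult_mat_vec[OF N Qbar, of "Qbar\<^sup>T *\<^sub>v v"] v
    by auto
  finally show ?thesis .
qed

end

section \<open>Normal vectors and projections of a set invariant along the range of
  \<open>Q\<close>\<close>

locale lineality_splitting = orthogonal_splitting +
  fixes C :: "real vec set"
  assumes C_carrier: "C \<subseteq> carrier_vec n"
    and lineality: "y \<in> C \<Longrightarrow> w \<in> carrier_vec k \<Longrightarrow> y + Q *\<^sub>v w \<in> C"
begin

text \<open>The test point \<open>p + Q *\<^sub>v (Q\<^sup>T *\<^sub>v u)\<close> stays in
  \<open>C\<close> by invariance. There the normality inequality says that the squared length of
  \<open>Q\<^sup>T *\<^sub>v u\<close> is at most 0.\<close>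

lemma normal_orthogonal:
  assumes u: "u \<in> carrier_vec n" and p: "p \<in> C"
    and normal: "\<And>y. y \<in> C \<Longrightarrow> u \<bullet> (y - p) \<le> 0"
  shows "Q\<^sup>T *\<^sub>v u = 0\<^sub>v k"
proof (rule self_scalar_prod_le_0)
  let ?w = "Q\<^sup>T *\<^sub>v u"
  show w: "?w \<in> carrier_vec k"
    using u by auto
  have p': "p \<in> carrier_vec n" and Qw: "Q *\<^sub>v ?w \<in> carrier_vec n"
    using p C_carrier w by auto
  have "(p + Q *\<^sub>v ?w) - p = Q *\<^sub>v ?w"
    using add_diff_cancel_left_vec[OF p' Qw] .
  then have "u \<bullet> (Q *\<^sub>v ?w) \<le> 0"
    using normal[OF lineality[OF p w]] by simp
  then show "?w \<bullet> ?w \<le> 0"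
    using scalar_prod_split[OF u Qw] w u by auto
qed

text \<open>Since the \<open>Q\<close> block of \<open>u\<close> vanishes, the inner product with
  \<open>y - p\<close> is carried entirely by the \<open>Qbar\<close> block. This serves both
  \<open>r\<close> and the residual \<open>x - p\<close> of a projection.\<close>

lemma normal_image:
  assumes u: "u \<in> carrier_vec n" and p: "p \<in> C" and y: "y \<in> C"
    and normal: "\<And>y. y \<in> C \<Longrightarrow> u \<bullet> (y - p) \<le> 0"
  shows "(Qbar\<^sup>T *\<^sub>v u) \<bullet> (Qbar\<^sup>T *\<^sub>v y - Qbar\<^sup>T *\<^sub>v p) \<le> 0"
proof -
  have py: "p \<in> carrier_vec n" "y \<in> carrier_vec n"
    using p y C_carrier by auto
  have "(Qbar\<^sup>T *\<^sub>v u) \<bullet> (Qbar\<^sup>T *\<^sub>v (y - p)) = u \<bullet> (y - p)"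
    using scalar_prod_split[of u "y - p"] normal_orthogonal[OF u p normal] u py
    by simp
  then show ?thesis
    using normal[OF y] py by (simp add: mult_minus_distrib_mat_vec[of _ l n])
qed

lemma proj_image:
  assumes x: "x \<in> carrier_vec n" and p: "p \<in> C"
    and VI: "\<And>y. y \<in> C \<Longrightarrow> (x - p) \<bullet> (y - p) \<le> 0"
  shows "Q\<^sup>T *\<^sub>v p = Q\<^sup>T *\<^sub>v x"
    and "euclidean_proj ((\<lambda>x. Qbar\<^sup>T *\<^sub>v x) ` C) (Qbar\<^sup>T *\<^sub>v x) = Qbar\<^sup>T *\<^sub>v p"
proof -
  have p': "p \<in> carrier_vec n" and xp: "x - p \<in> carrier_vec n"
    using p x C_carrier by auto
  have diff: "N *\<^sub>v (x - p) = N *\<^sub>v x - N *\<^sub>v p" if "N \<in> carrier_mat m n" for N m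
    using that x p' by (rule mult_minus_distrib_mat_vec)
  have "Q\<^sup>T *\<^sub>v x - Q\<^sup>T *\<^sub>v p = 0\<^sub>v k"
    using normal_orthogonal[OF xp p VI] diff[of "Q\<^sup>T" k] by simp
  moreover have "Q\<^sup>T *\<^sub>v x \<in> carrier_vec k" "Q\<^sup>T *\<^sub>v p \<in> carrier_vec k"
    using x p' by auto
  ultimately show "Q\<^sup>T *\<^sub>v p = Q\<^sup>T *\<^sub>v x"
    by (auto simp: vec_eq_iff)
  show "euclidean_proj ((\<lambda>x. Qbar\<^sup>T *\<^sub>v x) ` C) (Qbar\<^sup>T *\<^sub>v x) = Qbar\<^sup>T *\<^sub>v p"
  proof (rule euclidean_proj_eqI[of _ l])
    show "(\<lambda>x. Qbar\<^sup>T *\<^sub>v x) ` C \<subseteq> carrier_vec l" "Qbar\<^sup>T *\<^sub>v x \<in> carrier_vec l"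
      using C_carrier x by auto
    show "Qbar\<^sup>T *\<^sub>v p \<in> (\<lambda>x. Qbar\<^sup>T *\<^sub>v x) ` C"
      using p by simp
    fix y assume "y \<in> (\<lambda>x. Qbar\<^sup>T *\<^sub>v x) ` C"
    then show "(Qbar\<^sup>T *\<^sub>v x - Qbar\<^sup>T *\<^sub>v p) \<bullet> (y - Qbar\<^sup>T *\<^sub>v p) \<le> 0"
      using normal_image[OF xp p _ VI] diff[of "Qbar\<^sup>T" l] by auto
  qed
qed

end

section \<open>Block elimination by the Schur complement\<close>

locale lineality_invertible = orthogonal_splitting +
  fixes M :: "real mat"
  assumes M: "M \<in> carrier_mat n n" and invertible: "invertible_mat (sandwich Q M Q)"
begin

abbreviation "M_QQ \<equiv> sandwich Q M Q"
abbreviation "M_QQbar \<equiv> sandwich Q M Qbar"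
abbreviation "M_QbarQ \<equiv> sandwich Qbar M Q"
abbreviation "M_QbarQbar \<equiv> sandwich Qbar M Qbar"
abbreviation "schur \<equiv> M_QbarQbar - M_QbarQ * mat_inv M_QQ * M_QQbar"
abbreviation "schur_rhs \<equiv> \<lambda>q. (Qbar\<^sup>T - M_QbarQ * mat_inv M_QQ * Q\<^sup>T) *\<^sub>v q"

lemma block_carrier [simp]:
  "M_QQ \<in> carrier_mat k k" "M_QQbar \<in> carrier_mat k l" "M_QbarQ \<in> carrier_mat l k" "M_QbarQbar \<in> carrier_mat l l"
  "mat_inv M_QQ \<in> carrier_mat k k"
proof -
  show M_QQ: "M_QQ \<in> carrier_mat k k"
    and "M_QQbar \<in> carrier_mat k l" "M_QbarQ \<in> carrier_mat l k" "M_QbarQbar \<in> carrier_mat l l"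
    using M by (auto simp: sandwich_def intro!: mult_carrier_mat)
  show "mat_inv M_QQ \<in> carrier_mat k k"
    using mat_inv_inverse(1)[OF M_QQ invertible] .
qed

lemma mat_inv_mult_vec [simp]:
  assumes "w \<in> carrier_vec k"
  shows "M_QQ *\<^sub>v (mat_inv M_QQ *\<^sub>v w) = w" "mat_inv M_QQ *\<^sub>v (M_QQ *\<^sub>v w) = w"
  using assms mat_inv_inverse(2,3)[OF block_carrier(1) invertible]
    assoc_mult_mat_vec[of M_QQ k k "mat_inv M_QQ" k w] assoc_mult_mat_vec[of "mat_inv M_QQ" k k M_QQ k w]
  by simp_all

lemma block_vec_closed [simp]:
  "w \<in> carrier_vec k \<Longrightarrow> M_QQ *\<^sub>v w \<in> carrier_vec k"
  "w \<in> carrier_vec k \<Longrightarrow> mat_inv M_QQ *\<^sub>v w \<in> carrier_vec k"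
  "w \<in> carrier_vec k \<Longrightarrow> M_QbarQ *\<^sub>v w \<in> carrier_vec l"
  "z \<in> carrier_vec l \<Longrightarrow> M_QQbar *\<^sub>v z \<in> carrier_vec k"
  "z \<in> carrier_vec l \<Longrightarrow> M_QbarQbar *\<^sub>v z \<in> carrier_vec l"
  by (rule mult_mat_vec_carrier; simp)+

lemma blocks_mult_vec:
  assumes v: "v \<in> carrier_vec n"
  shows "Q\<^sup>T *\<^sub>v (M *\<^sub>v v) = M_QQ *\<^sub>v (Q\<^sup>T *\<^sub>v v) + M_QQbar *\<^sub>v (Qbar\<^sup>T *\<^sub>v v)"
    and "Qbar\<^sup>T *\<^sub>v (M *\<^sub>v v) = M_QbarQ *\<^sub>v (Q\<^sup>T *\<^sub>v v) + M_QbarQbar *\<^sub>v (Qbar\<^sup>T *\<^sub>v v)"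
proof -
  have "P *\<^sub>v (M *\<^sub>v v) = P * M * Q *\<^sub>v (Q\<^sup>T *\<^sub>v v) + P * M * Qbar *\<^sub>v (Qbar\<^sup>T *\<^sub>v v)"
    if P: "P \<in> carrier_mat m n" for P m
    using mult_vec_split[OF mult_carrier_mat[OF P M] v] assoc_mult_mat_vec[OF P M v] by simp
  from this[of "Q\<^sup>T" k] this[of "Qbar\<^sup>T" l]
  show "Q\<^sup>T *\<^sub>v (M *\<^sub>v v) = M_QQ *\<^sub>v (Q\<^sup>T *\<^sub>v v) + M_QQbar *\<^sub>v (Qbar\<^sup>T *\<^sub>v v)"
    and "Qbar\<^sup>T *\<^sub>v (M *\<^sub>v v) = M_QbarQ *\<^sub>v (Q\<^sup>T *\<^sub>v v) + M_QbarQbar *\<^sub>v (Qbar\<^sup>T *\<^sub>v v)"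
    by (auto simp: sandwich_def)
qed

text \<open>The vector multiplied by \<open>M_QbarQ\<close> on the right is the solution
  \<open>w\<close> of the first block row \<open>M_QQ *\<^sub>v w + M_QQbar *\<^sub>v z + Q\<^sup>T
  *\<^sub>v q = 0\<^sub>v k\<close>. Substituting it into the second block row produces the reduced
  matrix and right-hand side.\<close>

lemma schur_eliminate:
  assumes z: "z \<in> carrier_vec l" and q: "q \<in> carrier_vec n"
  shows "schur *\<^sub>v z + schur_rhs q
    = M_QbarQ *\<^sub>v (- (mat_inv M_QQ *\<^sub>v (M_QQbar *\<^sub>v z + Q\<^sup>T *\<^sub>v q))) + M_QbarQbar *\<^sub>v z + Qbar\<^sup>T *\<^sub>v q"
proof -
  have DA: "M_QbarQ * mat_inv M_QQ \<in> carrier_mat l k"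
    by (rule mult_carrier_mat[OF block_carrier(3,5)])
  let ?a = "M_QbarQ *\<^sub>v (mat_inv M_QQ *\<^sub>v (M_QQbar *\<^sub>v z))" and ?b = "M_QbarQ *\<^sub>v (mat_inv M_QQ *\<^sub>v (Q\<^sup>T *\<^sub>v q))"
  have "schur *\<^sub>v z = M_QbarQbar *\<^sub>v z - ?a"
    using z DA assoc_mult_mat_vec[OF DA block_carrier(2) z]
      assoc_mult_mat_vec[of M_QbarQ l k "mat_inv M_QQ" k "M_QQbar *\<^sub>v z"] mult_carrier_mat[OF DA block_carrier(2)]
    by (simp add: minus_mult_distrib_mat_vec[of _ l l])
  moreover have "schur_rhs q = Qbar\<^sup>T *\<^sub>v q - ?b"
    using q DA assoc_mult_mat_vec[OF DA Q_carrier(2) q]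
      assoc_mult_mat_vec[of M_QbarQ l k "mat_inv M_QQ" k "Q\<^sup>T *\<^sub>v q"] mult_carrier_mat[OF DA Q_carrier(2)]
    by (simp add: minus_mult_distrib_mat_vec[of _ l n])
  moreover have "M_QbarQ *\<^sub>v (- (mat_inv M_QQ *\<^sub>v (M_QQbar *\<^sub>v z + Q\<^sup>T *\<^sub>v q))) = - (?a + ?b)"
  proof -
    have "mat_inv M_QQ *\<^sub>v (M_QQbar *\<^sub>v z + Q\<^sup>T *\<^sub>v q)
        = mat_inv M_QQ *\<^sub>v (M_QQbar *\<^sub>v z) + mat_inv M_QQ *\<^sub>v (Q\<^sup>T *\<^sub>v q)"
      using z q by (intro mult_add_distrib_mat_vec[of _ k k]) auto
    moreover have "M_QbarQ *\<^sub>v (mat_inv M_QQ *\<^sub>v (M_QQbar *\<^sub>v z) + mat_inv M_QQ *\<^sub>v (Q\<^sup>T *\<^sub>v q)) = ?a + ?b"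
      using z q by (intro mult_add_distrib_mat_vec[of _ l k]) auto
    moreover have "M_QbarQ *\<^sub>v (- w) = - (M_QbarQ *\<^sub>v w)" if "w \<in> carrier_vec k" for w
      using mult_mat_vec[of M_QbarQ l k w "-1"] that by (simp add: uminus_vec_def smult_vec_def)
    ultimately show ?thesis
      using z q by simp
  qed
  moreover have "?a \<in> carrier_vec l" "?b \<in> carrier_vec l" "M_QbarQbar *\<^sub>v z \<in> carrier_vec l"
    "Qbar\<^sup>T *\<^sub>v q \<in> carrier_vec l"
    using z q by auto
  moreover have "e - a + (c - b) = - (a + b) + e + c"
    if "a \<in> carrier_vec l" "b \<in> carrier_vec l" "e \<in> carrier_vec l" "c \<in> carrier_vec l"
    for a b c e :: "real vec"
    using that by (intro eq_vecI) auto
  ultimately show ?thesis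
    by presburger
qed

text \<open>Here \<open>p\<close> stands for the projection of \<open>x\<close>, of which only the
  equality of \<open>Q\<close> blocks matters. The first conjunct is the \<open>Q\<close> block of
  the equation solved for \<open>Q\<^sup>T *\<^sub>v x\<close>; the second is the
  \<open>Qbar\<close> block after elimination.\<close>

lemma homotopy_eq_zero_iff:
  assumes q: "q \<in> carrier_vec n" and r: "r \<in> carrier_vec n"
    and x: "x \<in> carrier_vec n" and p: "p \<in> carrier_vec n"
    and Qxp: "Q\<^sup>T *\<^sub>v p = Q\<^sup>T *\<^sub>v x" and Qr: "Q\<^sup>T *\<^sub>v r = 0\<^sub>v k"
  shows "M *\<^sub>v p + q + x - p - t \<cdot>\<^sub>v r = 0\<^sub>v n \<longleftrightarrow>
    Q\<^sup>T *\<^sub>v x = - (mat_inv M_QQ *\<^sub>v (M_QQbar *\<^sub>v (Qbar\<^sup>T *\<^sub>v p) + Q\<^sup>T *\<^sub>v q)) \<and>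
    schur *\<^sub>v (Qbar\<^sup>T *\<^sub>v p) + schur_rhs q + Qbar\<^sup>T *\<^sub>v x - Qbar\<^sup>T *\<^sub>v p
      - t \<cdot>\<^sub>v (Qbar\<^sup>T *\<^sub>v r) = 0\<^sub>v l"
proof -
  let ?h = "M *\<^sub>v p + q + x - p - t \<cdot>\<^sub>v r" and ?z = "Qbar\<^sup>T *\<^sub>v p"
  let ?s = "M_QQbar *\<^sub>v ?z + Q\<^sup>T *\<^sub>v q"
  have Mp: "M *\<^sub>v p \<in> carrier_vec n"
    using M p by (rule mult_mat_vec_carrier)
  have s: "?s \<in> carrier_vec k"
    using p q by simp
  have h: "?h \<in> carrier_vec n"
    using Mp q x p r by auto
  have P: "P *\<^sub>v ?h = P *\<^sub>v (M *\<^sub>v p) + P *\<^sub>v q + P *\<^sub>v x - P *\<^sub>v p - t \<cdot>\<^sub>v (P *\<^sub>v r)"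
    if P: "P \<in> carrier_mat m n" for P m
    using P Mp q x p r mult_mat_vec[OF P r, of t] mult_mat_vec_carrier[OF P]
    by (simp add: mult_minus_distrib_mat_vec[OF P] mult_add_distrib_mat_vec[OF P]
        assoc_add_vec[of _ m])
  \<comment> \<open>In this block \<open>x\<close> and \<open>p\<close> have the same coordinates
    and cancel, while \<open>r\<close> contributes zero. What is left is linear in
    \<open>Q\<^sup>T *\<^sub>v x\<close> with the invertible coefficient
    \<open>M_QQ\<close>.\<close>
  have "Q\<^sup>T *\<^sub>v ?h = M_QQ *\<^sub>v (Q\<^sup>T *\<^sub>v x) + M_QQbar *\<^sub>v ?z + Q\<^sup>T *\<^sub>v q + Q\<^sup>T *\<^sub>v x - Q\<^sup>T *\<^sub>v x - t \<cdot>\<^sub>v 0\<^sub>v k"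
    using P[of "Q\<^sup>T" k] blocks_mult_vec(1)[OF p] by (simp add: Qxp Qr)
  also have "\<dots> = M_QQ *\<^sub>v (Q\<^sup>T *\<^sub>v x) + ?s"
  proof -
    have "a + b + c + w - w - t \<cdot>\<^sub>v 0\<^sub>v k = a + (b + c)"
      if "a \<in> carrier_vec k" "b \<in> carrier_vec k" "c \<in> carrier_vec k" "w \<in> carrier_vec k"
      for a b c w :: "real vec"
      using that by (intro eq_vecI) auto
    from this[of "M_QQ *\<^sub>v (Q\<^sup>T *\<^sub>v x)" "M_QQbar *\<^sub>v ?z" "Q\<^sup>T *\<^sub>v q" "Q\<^sup>T *\<^sub>v x"] show ?thesis
      using p q x by simp
  qed
  finally have Qh: "Q\<^sup>T *\<^sub>v ?h = M_QQ *\<^sub>v (Q\<^sup>T *\<^sub>v x) + ?s" .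
  have first: "Q\<^sup>T *\<^sub>v ?h = 0\<^sub>v k \<longleftrightarrow> Q\<^sup>T *\<^sub>v x = - (mat_inv M_QQ *\<^sub>v ?s)"
  proof
    assume "Q\<^sup>T *\<^sub>v ?h = 0\<^sub>v k"
    then have "mat_inv M_QQ *\<^sub>v (M_QQ *\<^sub>v (Q\<^sup>T *\<^sub>v x) + ?s) = 0\<^sub>v k"
      using mult_mat_zero_vec[OF block_carrier(5)] by (simp add: Qh)
    then have "Q\<^sup>T *\<^sub>v x + mat_inv M_QQ *\<^sub>v ?s = 0\<^sub>v k"
      using s x mult_add_distrib_mat_vec[OF block_carrier(5), of "M_QQ *\<^sub>v (Q\<^sup>T *\<^sub>v x)" ?s] by simp
    then show "Q\<^sup>T *\<^sub>v x = - (mat_inv M_QQ *\<^sub>v ?s)"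
      using s x eq_if_diff_eq_zero_vec[of "Q\<^sup>T *\<^sub>v x" k "- (mat_inv M_QQ *\<^sub>v ?s)"]
        minus_add_uminus_vec[of "Q\<^sup>T *\<^sub>v x" k "- (mat_inv M_QQ *\<^sub>v ?s)"] by simp
  next
    assume Qx: "Q\<^sup>T *\<^sub>v x = - (mat_inv M_QQ *\<^sub>v ?s)"
    have "M_QQ *\<^sub>v (- (mat_inv M_QQ *\<^sub>v ?s)) = - ?s"
      using mult_mat_vec[of M_QQ k k "mat_inv M_QQ *\<^sub>v ?s" "-1"] s
      by (simp add: uminus_vec_def smult_vec_def)
    then show "Q\<^sup>T *\<^sub>v ?h = 0\<^sub>v k"
      using s by (simp add: Qh Qx)
  qed
  \<comment> \<open>The \<open>Qbar\<close> block is rewritten as the reduced map by substituting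
    the solved first block, so the identity is stated conditionally on \<open>Qx\<close>.\<close>
  have second: "Qbar\<^sup>T *\<^sub>v ?h = schur *\<^sub>v ?z + schur_rhs q + Qbar\<^sup>T *\<^sub>v x - ?z - t \<cdot>\<^sub>v (Qbar\<^sup>T *\<^sub>v r)"
    if Qx: "Q\<^sup>T *\<^sub>v x = - (mat_inv M_QQ *\<^sub>v ?s)"
    using P[of "Qbar\<^sup>T" l] blocks_mult_vec(2)[OF p] schur_eliminate[of ?z q] p q
    by (simp add: Qxp Qx)
  show ?thesis
    using eq_zero_iff[OF h] first second by auto
qed

end

section \<open>From orthonormal bases to the splitting, and assembly of the result\<close>

text \<open>The resolution of the identity comes without a dimension count: the residual
  \<open>u\<close> of \<open>v\<close> is orthogonal to the range of \<open>Q\<close>, hence equals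
  \<open>Qbar *\<^sub>v z\<close> for some \<open>z\<close>, and applying
  \<open>Qbar\<^sup>T\<close> identifies \<open>z\<close> as
  \<open>Qbar\<^sup>T *\<^sub>v v\<close>.\<close>

lemma orthogonal_splitting_complement:
  assumes Q: "orthonormal_basis_cols n k Q L"
    and Qbar: "orthonormal_basis_cols n l Qbar (vec_module.orthogonal_complement n L)"
  shows "orthogonal_splitting n k l Q Qbar"
proof
  note Q = orthonormal_basis_colsD[OF Q] and Qbar = orthonormal_basis_colsD[OF Qbar]
  \<comment> \<open>Columns are values at unit vectors, so orthogonality of the two ranges
    specializes to orthogonality of columns.\<close>
  have unit: "P *\<^sub>v unit_vec m j = col P j" if "P \<in> carrier_mat n m" "j < m" for P :: "real mat" and m j
    using that by (intro eq_vecI) auto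
  have orth: "(Q *\<^sub>v w) \<bullet> (Qbar *\<^sub>v z) = 0" if "w \<in> carrier_vec k" "z \<in> carrier_vec l" for w z
  proof -
    have "(Qbar *\<^sub>v z) \<bullet> (Q *\<^sub>v w) = 0"
      using that Q(3) Qbar(3) unfolding vec_module.orthogonal_complement_def by blast
    then show ?thesis
      using comm_scalar_prod[of "Q *\<^sub>v w" n "Qbar *\<^sub>v z"] Q(1) Qbar(1) that
      by (metis mult_mat_vec_carrier)
  qed
  show "Q \<in> carrier_mat n k" "Qbar \<in> carrier_mat n l"
    and "Q\<^sup>T * Q = 1\<^sub>m k" and QbQb: "Qbar\<^sup>T * Qbar = 1\<^sub>m l"
    by (fact Q Qbar)+
  have cols: "col Q i \<bullet> col Qbar j = 0" "col Qbar j \<bullet> col Q i = 0" if "i < k" "j < l" for i j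
    using orth[of "unit_vec k i" "unit_vec l j"] unit[OF Q(1), of i] unit[OF Qbar(1), of j] that
      comm_scalar_prod[of "col Qbar j" n "col Q i"] Q(1) Qbar(1)
    by auto
  show "Q\<^sup>T * Qbar = 0\<^sub>m k l" and QbQ: "Qbar\<^sup>T * Q = 0\<^sub>m l k"
    using Q(1) Qbar(1) cols by (auto intro!: eq_matI)
  fix v :: "real vec" assume v: "v \<in> carrier_vec n"
  define u where "u = v - Q *\<^sub>v (Q\<^sup>T *\<^sub>v v)"
  have closed: "Q\<^sup>T *\<^sub>v v \<in> carrier_vec k" "Q *\<^sub>v (Q\<^sup>T *\<^sub>v v) \<in> carrier_vec n"
    using Q(1) v by (meson mult_mat_vec_carrier transpose_carrier_mat)+
  then have u: "u \<in> carrier_vec n"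
    using v by (simp add: u_def)
  have "u \<bullet> (Q *\<^sub>v w) = 0" if w: "w \<in> carrier_vec k" for w
  proof -
    have Qw: "Q *\<^sub>v w \<in> carrier_vec n" using Q(1) w by simp
    have "Q\<^sup>T *\<^sub>v (Q *\<^sub>v w) = w"
      using assoc_mult_mat_vec[of "Q\<^sup>T" k n Q k w] Q w by simp
    then have "(Q *\<^sub>v (Q\<^sup>T *\<^sub>v v)) \<bullet> (Q *\<^sub>v w) = (Q\<^sup>T *\<^sub>v v) \<bullet> w"
      using transpose_vec_mult_scalar[OF Q(1) closed(1) Qw] comm_scalar_prod[OF closed(2) Qw]
        comm_scalar_prod[OF closed(1) w] by simp
    also have "\<dots> = v \<bullet> (Q *\<^sub>v w)"
      using transpose_vec_mult_scalar[OF Q(1) w v] by simp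
    finally show ?thesis
      using v closed(2) Qw by (simp add: u_def minus_scalar_prod_distrib[of _ n])
  qed
  then have "u \<in> vec_module.orthogonal_complement n L"
    using u Q(3) unfolding vec_module.orthogonal_complement_def by auto
  then obtain z where z: "z \<in> carrier_vec l" and uz: "u = Qbar *\<^sub>v z"
    using Qbar(3) by auto
  have "Qbar\<^sup>T *\<^sub>v u = z"
    using assoc_mult_mat_vec[of "Qbar\<^sup>T" l n Qbar l z] Qbar z by (simp add: uz)
  moreover have "Qbar\<^sup>T *\<^sub>v (Q *\<^sub>v (Q\<^sup>T *\<^sub>v v)) = 0\<^sub>v l"
    using assoc_mult_mat_vec[of "Qbar\<^sup>T" l n Q k "Q\<^sup>T *\<^sub>v v"] Q(1) Qbar(1) closed(1) QbQ
    by (simp add: zero_mat_mult_vec)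
  ultimately have "Qbar\<^sup>T *\<^sub>v v = z"
    using mult_minus_distrib_mat_vec[of "Qbar\<^sup>T" l n v "Q *\<^sub>v (Q\<^sup>T *\<^sub>v v)"] Qbar(1) v closed(2)
      mult_mat_vec_carrier[of "Qbar\<^sup>T" l n v]
    by (simp add: u_def)
  then show "Q *\<^sub>v (Q\<^sup>T *\<^sub>v v) + Qbar *\<^sub>v (Qbar\<^sup>T *\<^sub>v v) = v"
    using add_diff_cancel_right_vec[OF closed(2) v] uz by (simp add: u_def)
qed

theorem proposition3p7:
  fixes n k l :: nat
    and C C' :: "real vec set"
    and q r x0 q' r' x0' :: "real vec"
    and M Q Qbar M' :: "real mat"
  assumes "polyhedral_convex n C" and "C \<noteq> {}"
    and "q \<in> carrier_vec n" and "M \<in> carrier_mat n n"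
    and "orthonormal_basis_cols n k Q (lineality_space n C)"
    and "orthonormal_basis_cols n l Qbar
           (vec_module.orthogonal_complement n (lineality_space n C))"
    and "invertible_mat (sandwich Q M Q)"
    and "x0 \<in> carrier_vec n"
    and "r \<in> normal_cone n C (euclidean_proj C x0)"
    and M': "M' = sandwich Qbar M Qbar
               - sandwich Qbar M Q * mat_inv (sandwich Q M Q) * sandwich Q M Qbar"
    and C': "C' = (\<lambda>x. Qbar\<^sup>T *\<^sub>v x) ` C"
    and q': "q' = (Qbar\<^sup>T - sandwich Qbar M Q * mat_inv (sandwich Q M Q) * Q\<^sup>T) *\<^sub>v q"
    and x0': "x0' = Qbar\<^sup>T *\<^sub>v x0"
    and r': "r' = Qbar\<^sup>T *\<^sub>v r"
  shows "r' \<in> normal_cone l C' (euclidean_proj C' x0') \<and>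
    (\<forall>x \<in> carrier_vec n. \<forall>t\<ge>0.
       normal_map_homotopy C q M r x t = 0\<^sub>v n \<longrightarrow>
       normal_map_homotopy C' q' M' r' (Qbar\<^sup>T *\<^sub>v x) t = 0\<^sub>v l) \<and>
    (\<forall>x' \<in> carrier_vec l. \<forall>t\<ge>0.
       normal_map_homotopy C' q' M' r' x' t = 0\<^sub>v l \<longrightarrow>
       (let y = - (mat_inv (sandwich Q M Q) *\<^sub>v
                     (sandwich Q M Qbar *\<^sub>v euclidean_proj C' x' + Q\<^sup>T *\<^sub>v q))
        in normal_map_homotopy C q M r (Qbar *\<^sub>v x' + Q *\<^sub>v y) t = 0\<^sub>v n))"
proof -
  note poly = assms(1,2) and q = assms(3) and M = assms(4)
  interpret orthogonal_splitting n k l Q Qbar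
    using orthogonal_splitting_complement assms(5,6) .
  interpret lineality_invertible n k l Q Qbar M
    by unfold_locales (use M assms(7) in auto)
  have lin: "Q *\<^sub>v w \<in> lineality_space n C" if "w \<in> carrier_vec k" for w
    using orthonormal_basis_colsD(3)[OF assms(5)] that by auto
  interpret lineality_splitting n k l Q Qbar C
    by unfold_locales (use polyhedral_convexD(1)[OF assms(1)] lineality_space_add[OF _ lin] in auto)
  define P where "P = euclidean_proj C"
  have P: "P x \<in> C" and VI: "\<And>y. y \<in> C \<Longrightarrow> (x - P x) \<bullet> (y - P x) \<le> 0"
    if "x \<in> carrier_vec n" for x
    using polyhedral_convex_proj[OF poly that] by (auto simp: P_def)
  have P_carrier: "P x \<in> carrier_vec n" if "x \<in> carrier_vec n" for x
    using P[OF that] C_carrier by auto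
  have QP: "Q\<^sup>T *\<^sub>v P x = Q\<^sup>T *\<^sub>v x"
    and proj': "euclidean_proj C' (Qbar\<^sup>T *\<^sub>v x) = Qbar\<^sup>T *\<^sub>v P x"
    if "x \<in> carrier_vec n" for x
    using proj_image[OF that P[OF that] VI[OF that]] by (auto simp: C')
  have r: "r \<in> carrier_vec n" and normal: "\<And>y. y \<in> C \<Longrightarrow> r \<bullet> (y - P x0) \<le> 0"
    using assms(9) by (auto simp: normal_cone_def P_def)
  have Qr: "Q\<^sup>T *\<^sub>v r = 0\<^sub>v k"
    using normal_orthogonal[OF r P[OF assms(8)] normal] .
  have G_iff: "normal_map_homotopy C q M r x t = 0\<^sub>v n \<longleftrightarrow>
      Q\<^sup>T *\<^sub>v x = - (mat_inv M_QQ *\<^sub>v (M_QQbar *\<^sub>v euclidean_proj C' (Qbar\<^sup>T *\<^sub>v x) + Q\<^sup>T *\<^sub>v q)) \<and>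
      normal_map_homotopy C' q' M' r' (Qbar\<^sup>T *\<^sub>v x) t = 0\<^sub>v l"
    if x: "x \<in> carrier_vec n" for x t
    using homotopy_eq_zero_iff[OF q r x P_carrier[OF x] QP[OF x] Qr, of t]
    unfolding normal_map_homotopy_def proj'[OF x] M' q' r' P_def[symmetric] .
  have "r' \<in> normal_cone l C' (euclidean_proj C' x0')"
    using normal_image[OF r P[OF assms(8)] _ normal] r proj'[OF assms(8)]
    by (auto simp: normal_cone_def r' x0' C')
  moreover have "normal_map_homotopy C q M r (Qbar *\<^sub>v x' + Q *\<^sub>v y) t = 0\<^sub>v n"
    if x': "x' \<in> carrier_vec l" and G': "normal_map_homotopy C' q' M' r' x' t = 0\<^sub>v l"
      and y: "y = - (mat_inv M_QQ *\<^sub>v (M_QQbar *\<^sub>v euclidean_proj C' x' + Q\<^sup>T *\<^sub>v q))" for x' y t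
  proof -
    \<comment> \<open>Every \<open>x'\<close> is \<open>Qbar\<^sup>T\<close> applied to
      \<open>Qbar *\<^sub>v x'\<close>, so \<open>proj'\<close> expresses its projection onto
      \<open>C'\<close> through a projection onto \<open>C\<close>.\<close>
    have proj'_carrier: "euclidean_proj C' x' \<in> carrier_vec l"
      using proj'[of "Qbar *\<^sub>v x'"] P_carrier[of "Qbar *\<^sub>v x'"] x' by simp
    then have y_carrier: "y \<in> carrier_vec k"
      using q by (simp add: y)
    let ?x = "Qbar *\<^sub>v x' + Q *\<^sub>v y"
    \<comment> \<open>The blocks of the lifted point are \<open>y\<close> and \<open>x'\<close>, so
      the first conjunct of \<open>G_iff\<close> becomes the defining equation of
      \<open>y\<close>.\<close>
    have "Q\<^sup>T *\<^sub>v ?x = y" "Qbar\<^sup>T *\<^sub>v ?x = x'" "?x \<in> carrier_vec n"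
      using x' y_carrier
      by (simp_all add: mult_add_distrib_mat_vec[of _ k n] mult_add_distrib_mat_vec[of _ l n])
    then show ?thesis
      using G_iff[of ?x t] G' y by simp
  qed
  ultimately show ?thesis
    using G_iff by (auto simp: Let_def)
qed

end
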